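(* Fix $q\in\mathbb R$. Assume that $\beta(q)\notin\{-dq,1-dq,\dots,d-dq\}$. Let $(t_{q,n})_n$ be an increasing sequence of positive real numbers with $t_{q,n}\to\infty$ such that for every real number $c$ there is a constant $k_c$ with $|\zeta_\mu^q(\sigma\pm\mathrm it_{q,n})|\le k_c$ for all $\sigma\le c$ and all $n$. Then for all $0<r<r_{\min}$, $$V_{\mu,r}^{q,\mathrm{sym}}(K)=\lim_{n}\ \sum_{\omega\in P(\zeta_\mu^q),\ |\operatorname{Im}(\omega)|\le t_{q,n}}\operatorname{res}\big(s\mapsto Z_\mu^q(s)\,r^{-s};\,\omega\big).$$
   Context: Let $d\ge1$ and $N\ge2$ be integers, $S_1,\dots,S_N:\mathbb R^d\to\mathbb R^d$ contracting similarities with ratios $r_1,\dots,r_N\in(0,1)$, and $(p_1,\dots,p_N)$ a probability vector with all $p_i>0$. $K$ is the self-similar set ($K$ non-empty compact, $K=\bigcup_iS_i(K)$) and $\mu$ the self-similar measure ($\mu=\sum_ip_i\mu\circ S_i^{-1}$, a Borel probability measure). For $q\in\mathbb R$, $\beta(q)$ is the unique real number with $\sum_ip_i^qr_i^{\beta(q)}=1$. $r_{\min}=\min_ir_i$. $\Sigma^*$ is the set of all finite non-empty strings $\mathbf i=i_1\dots i_m$ over $\{1,\dots,N\}$; $r_{\mathbf i}=r_{i_1}\cdots r_{i_m}$, $p_{\mathbf i}=p_{i_1}\cdots p_{i_m}$, and $\hat{\mathbf i}=i_1\dots i_{m-1}$ is the parent of $\mathbf i$ (for the empty string $r_\varnothing=1$).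 For $l=0,1,\dots,d$ put $\sigma_{q,l}=\sum_{i=1}^Np_i^qr_i^{l-dq}$ and $$C_{\mu,r}^{q,l,\mathrm{sym}}(K)=\sum_{\mathbf i\in\Sigma^*,\ r_{\mathbf i}<r<r_{\hat{\mathbf i}}}p_{\mathbf i}^qr_{\mathbf i}^{l-dq}+\frac{1+\frac1{\sigma_{q,l}}}2\sum_{\mathbf i\in\Sigma^*,\ r=r_{\hat{\mathbf i}}}p_{\mathbf i}^qr_{\mathbf i}^{l-dq}.$$ Let $\kappa_\mu^{q,0}(K),\dots,\kappa_\mu^{q,d}(K)$ be arbitrary real numbers satisfying the consistency condition $\sum_{l=0}^d\kappa_\mu^{q,l}(K)(\sigma_{q,l}-1)=0$. The symbolic $q$ multifractal Minkowski volume is $$V_{\mu,r}^{q,\mathrm{sym}}(K)=\sum_{l=0}^d\kappa_\mu^{q,l}(K)\,C_{\mu,r}^{q,l,\mathrm{sym}}(K)\,r^{-l+dq}.$$ The multifractal zeta-function is the meromorphic function $\zeta_\mu^q(s)=\frac{\sum_ip_i^qr_i^s}{1-\sum_ip_i^qr_i^s}$ on $\mathbb C$, and $Z_\mu^q(s)=\Big(\sum_{l=0}^d\frac{\kappa_\mu^{q,l}(K)(\sigma_{q,l}-1)}{s-(l-dq)}\Big)\zeta_\mu^q(s)$. $P(f)$ is the set of poles of a meromorphic function $f$ and $\operatorname{res}(f;\omega)$ is the residue of $f$ at $\omega$. The bound on $|\zeta_\mu^q(\sigma\pm\mathrm it_{q,n})|$ includes the requirement that these points are not poles; the paper proves separately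 that a sequence $(t_{q,n})_n$ as required exists for every $q$. *)

theory Defs
  imports "HOL-Probability.Probability" "HOL-Complex_Analysis.Complex_Analysis"
begin

definition similarity_with_ratio :: "real \<Rightarrow> (real ^ 'n \<Rightarrow> real ^ 'n) \<Rightarrow> bool" where
  "similarity_with_ratio c T \<longleftrightarrow> (\<forall>x y. dist (T x) (T y) = c * dist x y)"

definition self_similar_set ::
    "nat \<Rightarrow> (nat \<Rightarrow> real ^ 'n \<Rightarrow> real ^ 'n) \<Rightarrow> (real ^ 'n) set \<Rightarrow> bool" where
  "self_similar_set N S K \<longleftrightarrow> K \<noteq> {} \<and> compact K \<and> K = (\<Union>i\<in>{1..N}. S i ` K)"

definition self_similar_measure ::
    "nat \<Rightarrow> (nat \<Rightarrow> real ^ 'n \<Rightarrow> real ^ 'n) \<Rightarrow> (nat \<Rightarrow> real) \<Rightarrow> (real ^ 'n) measure \<Rightarrow> bool" where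
  "self_similar_measure N S p M \<longleftrightarrow>
     prob_space M \<and> sets M = sets borel \<and>
     (\<forall>A\<in>sets borel. measure M A = (\<Sum>i=1..N. p i * measure M (S i -` A)))"

definition beta_exponent :: "nat \<Rightarrow> (nat \<Rightarrow> real) \<Rightarrow> (nat \<Rightarrow> real) \<Rightarrow> real \<Rightarrow> real" where
  "beta_exponent N p r q = (THE b. (\<Sum>i=1..N. p i powr q * r i powr b) = 1)"

definition words :: "nat \<Rightarrow> nat list set" where
  "words N = {w. w \<noteq> [] \<and> set w \<subseteq> {1..N}}"

text \<open>The product \<open>a\<^sub>w\<close> of \<open>a\<close> along the string \<open>w\<close>, equal to 1 on the empty string.
  The parent of a string \<open>w\<close> is \<open>butlast w\<close>.\<close>

definition word_prod :: "(nat \<Rightarrow> real) \<Rightarrow> nat list \<Rightarrow> real" where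
  "word_prod a w = prod_list (map a w)"

definition sigma_ql ::
    "nat \<Rightarrow> (nat \<Rightarrow> real) \<Rightarrow> (nat \<Rightarrow> real) \<Rightarrow> nat \<Rightarrow> real \<Rightarrow> nat \<Rightarrow> real" where
  "sigma_ql N p r d q l = (\<Sum>i=1..N. p i powr q * r i powr (real l - real d * q))"

text \<open>For \<open>\<rho> > 0\<close> and ratios in \<open>(0,1)\<close> both index sets below are finite, since the lower
  bound \<open>\<rho> \<le> r\<^bsub>butlast w\<^esub>\<close> bounds the length of \<open>w\<close>.\<close>

definition C_sym ::
    "nat \<Rightarrow> (nat \<Rightarrow> real) \<Rightarrow> (nat \<Rightarrow> real) \<Rightarrow> nat \<Rightarrow> real \<Rightarrow> nat \<Rightarrow> real \<Rightarrow> real" where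
  "C_sym N p r d q l \<rho> =
     (\<Sum>w | w \<in> words N \<and> word_prod r w < \<rho> \<and> \<rho> < word_prod r (butlast w).
        word_prod p w powr q * word_prod r w powr (real l - real d * q))
   + (1 + 1 / sigma_ql N p r d q l) / 2 *
     (\<Sum>w | w \<in> words N \<and> \<rho> = word_prod r (butlast w).
        word_prod p w powr q * word_prod r w powr (real l - real d * q))"

text \<open>The coefficients \<open>\<kappa> 0, \<dots>, \<kappa> d\<close> carry the only dependence on the self-similar set and
  measure that is not already contained in \<open>p\<close> and \<open>r\<close>.\<close>

definition V_sym ::
    "nat \<Rightarrow> (nat \<Rightarrow> real) \<Rightarrow> (nat \<Rightarrow> real) \<Rightarrow> nat \<Rightarrow> (nat \<Rightarrow> real) \<Rightarrow> real \<Rightarrow> real \<Rightarrow> real" where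
  "V_sym N p r d \<kappa> q \<rho> =
     (\<Sum>l=0..d. \<kappa> l * C_sym N p r d q l \<rho> * \<rho> powr (- real l + real d * q))"

text \<open>The meromorphic functions are represented by total functions; their values at the
  (isolated) zeros of the denominators are an artefact of \<open>x / 0 = 0\<close>, and neither
  \<^const>\<open>is_pole\<close> nor \<^const>\<open>residue\<close> depends on them.\<close>

definition zeta_mu ::
    "nat \<Rightarrow> (nat \<Rightarrow> real) \<Rightarrow> (nat \<Rightarrow> real) \<Rightarrow> real \<Rightarrow> complex \<Rightarrow> complex" where
  "zeta_mu N p r q s =
     (\<Sum>i=1..N. complex_of_real (p i powr q) * complex_of_real (r i) powr s) /
     (1 - (\<Sum>i=1..N. complex_of_real (p i powr q) * complex_of_real (r i) powr s))"

definition Z_mu ::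
    "nat \<Rightarrow> (nat \<Rightarrow> real) \<Rightarrow> (nat \<Rightarrow> real) \<Rightarrow> nat \<Rightarrow> (nat \<Rightarrow> real) \<Rightarrow> real \<Rightarrow> complex \<Rightarrow> complex" where
  "Z_mu N p r d \<kappa> q s =
     (\<Sum>l=0..d. complex_of_real (\<kappa> l * (sigma_ql N p r d q l - 1)) /
                (s - complex_of_real (real l - real d * q))) * zeta_mu N p r q s"

end

theory Submission imports Defs begin

text \<open>
  Write \<open>F s = (\<Sum>i. p\<^sub>i\<^sup>q r\<^sub>i\<^sup>s)\<close>, so that \<open>\<zeta> = F / (1 - F)\<close>, and let \<open>u\<^sub>l = l - d q\<close> and
  \<open>c\<^sub>l = \<kappa>\<^sub>l (\<sigma>\<^sub>l - 1)\<close>, where \<open>\<sigma>\<^sub>l = F u\<^sub>l\<close>. The consistency condition \<open>(\<Sum>l. c\<^sub>l) = 0\<close> is what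
  makes \<open>A s = (\<Sum>l. c\<^sub>l / (s - u\<^sub>l))\<close> of order \<open>1 / s\<^sup>2\<close> at infinity.

  Formally, \<open>\<zeta>\<close> is the sum of \<open>p\<^sub>w\<^sup>q r\<^sub>w\<^sup>s\<close> over all words \<open>w\<close>. Let \<open>W s\<close> be the finite part of this
  sum over the words with \<open>\<rho> \<le> r\<^sub>w\<close>. The proof consists in moving \<open>W\<close> to the other side: the
  function \<open>H s = A s \<rho>\<^bsup>-s\<^esup> (\<zeta> s - W s)\<close> has the same residues as \<open>Z s \<rho>\<^bsup>-s\<^esup>\<close> at the poles of \<open>\<zeta>\<close>,
  and \<open>\<rho>\<^bsup>-s\<^esup> (\<zeta> s - W s)\<close> is bounded on the boundaries of the squares
  \<open>{s. \<bar>Re s\<bar> \<le> t\<^sub>n \<and> \<bar>Im s\<bar> \<le> t\<^sub>n}\<close>, uniformly in all large \<open>n\<close>: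

  \<^item> To the left of any vertical line \<open>\<rho>\<^bsup>-s\<^esup>\<close> is bounded because \<open>\<rho> < 1\<close>, and \<open>\<rho>\<^bsup>-s\<^esup> W s\<close> is bounded
    because it only involves words with \<open>1 \<le> r\<^sub>w / \<rho>\<close>. There \<open>\<zeta>\<close> is bounded on the horizontal sides
    by the choice of \<open>t\<close>, and on the left side because \<open>\<bar>F\<bar>\<close> is large
    (\<open>remainder_bounded_left\<close>, \<open>zeta_bounded_on_left\<close>).
  \<^item> On the right, the finite tree of words with \<open>\<rho> \<le> r\<^sub>w\<close> satisfies a renewal identity
    (\<open>renewal_identity\<close>), which turns \<open>\<zeta> - W\<close> into \<open>X / (1 - F)\<close>. Here \<open>X\<close> is the finite sum of
    \<open>p\<^sub>w\<^sup>q r\<^sub>w\<^sup>s\<close> over the words with \<open>r\<^sub>w < \<rho>\<close> whose parents lie in the tree. Now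
    \<open>\<rho>\<^bsup>-s\<^esup> X s\<close> is bounded since \<open>r\<^sub>w / \<rho> < 1\<close> for these words, and \<open>\<bar>F\<bar> \<le> 1 / 2\<close> far to the right
    (\<open>remainder_bounded_right\<close>).

  Hence \<open>H\<close> is of order \<open>1 / t\<^sub>n\<^sup>2\<close> on contours of length \<open>8 t\<^sub>n\<close>, and the sum of its residues in the
  squares tends to 0. All poles of \<open>\<zeta>\<close> lie in a vertical strip, so large squares contain every
  pole with \<open>\<bar>Im \<omega>\<bar> \<le> t\<^sub>n\<close>; the only other possible singularities of \<open>H\<close> are the points \<open>u\<^sub>l\<close>, which are
  not poles of \<open>\<zeta>\<close> because \<open>\<beta>(q) \<noteq> u\<^sub>l\<close>. The wanted limit is therefore minus the sum of the residues
  at the \<open>u\<^sub>l\<close>, namely \<open>(\<Sum>l. \<kappa>\<^sub>l (\<sigma>\<^sub>l + (\<sigma>\<^sub>l - 1) W u\<^sub>l) \<rho>\<^bsup>-u\<^sub>l\<^esup>)\<close>. The renewal identity at the real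
  point \<open>u\<^sub>l\<close> rewrites \<open>C_sym\<close> in terms of \<open>W u\<^sub>l\<close> and shows that this number is \<open>V_sym\<close>
  (\<open>V_sym_eq\<close>).
\<close>

section \<open>Words and the renewal identity\<close>

lemma sum_children:
  fixes f :: "nat \<Rightarrow> 'b::comm_semiring_1"
  assumes "V \<subseteq> lists {1..N}"
  shows "(\<Sum>w | w \<in> words N \<and> butlast w \<in> V. prod_list (map f w)) =
    (\<Sum>i=1..N. f i) * (\<Sum>v\<in>V. prod_list (map f v))"
proof -
  have "(\<Sum>w | w \<in> words N \<and> butlast w \<in> V. prod_list (map f w)) =
    (\<Sum>(v, i)\<in>V \<times> {1..N}. prod_list (map f v) * f i)"
  proof (rule sum.reindex_bij_witness[of _ "\<lambda>(v, i). v @ [i]" "\<lambda>w. (butlast w, last w)"])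
    fix w assume w: "w \<in> {w. w \<in> words N \<and> butlast w \<in> V}"
    then have "w \<noteq> []" and "set w \<subseteq> {1..N}" by (auto simp: words_def)
    then show "(case (butlast w, last w) of (v, i) \<Rightarrow> v @ [i]) = w"
      and "(butlast w, last w) \<in> V \<times> {1..N}"
      using w last_in_set[of w] by (auto simp del: atLeastAtMost_iff)
    show "(case (butlast w, last w) of (v, i) \<Rightarrow> prod_list (map f v) * f i) = prod_list (map f w)"
      by (subst (3) append_butlast_last_id[OF \<open>w \<noteq> []\<close>, symmetric], subst map_append) simp
  next
    fix b assume "b \<in> V \<times> {1..N}"
    then show "(butlast (case b of (v, i) \<Rightarrow> v @ [i]), last (case b of (v, i) \<Rightarrow> v @ [i])) = b"
      and "(case b of (v, i) \<Rightarrow> v @ [i]) \<in> {w. w \<in> words N \<and> butlast w \<in> V}"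
      using assms by (auto simp: words_def)
  qed
  also have "\<dots> = (\<Sum>i=1..N. f i) * (\<Sum>v\<in>V. prod_list (map f v))"
    unfolding mult.commute[of "sum f _"] by (simp add: sum.cartesian_product[symmetric] sum_product)
  finally show ?thesis .
qed

definition long_words :: "nat \<Rightarrow> (nat \<Rightarrow> real) \<Rightarrow> real \<Rightarrow> nat list set" where
  "long_words N r \<rho> = {w \<in> words N. \<rho> \<le> word_prod r w}"

definition cut_words :: "nat \<Rightarrow> (nat \<Rightarrow> real) \<Rightarrow> real \<Rightarrow> nat list set" where
  "cut_words N r \<rho> = {w \<in> words N. word_prod r w < \<rho> \<and> \<rho> \<le> word_prod r (butlast w)}"

lemma word_prod_pos:
  assumes "\<And>i. i \<in> set w \<Longrightarrow> 0 < r i"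
  shows "0 < word_prod r w"
  using assms unfolding word_prod_def by (induction w) auto

lemma words_in_lists: "w \<in> words N \<Longrightarrow> w \<in> lists {1..N}"
  by (auto simp: words_def)

locale ratio_list =
  fixes N :: nat and r :: "nat \<Rightarrow> real"
  assumes N_pos: "0 < N"
    and r_pos: "\<And>i. i \<in> {1..N} \<Longrightarrow> 0 < r i"
    and r_less_1: "\<And>i. i \<in> {1..N} \<Longrightarrow> r i < 1"
begin

lemma word_prod_r_pos: "w \<in> lists {1..N} \<Longrightarrow> 0 < word_prod r w"
  using r_pos by (intro word_prod_pos) auto

lemma word_prod_butlast_greater:
  assumes "w \<in> words N"
  shows "word_prod r w < word_prod r (butlast w)"
proof -
  from assms have ne: "w \<noteq> []" and last: "last w \<in> {1..N}"
    using last_in_set[of w] by (auto simp: words_def simp del: atLeastAtMost_iff)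
  have "butlast w \<in> lists {1..N}"
    using assms by (auto simp: words_def dest: in_set_butlastD)
  moreover have "word_prod r w = word_prod r (butlast w) * r (last w)"
    unfolding word_prod_def
    by (subst append_butlast_last_id[OF ne, symmetric], subst map_append) simp
  ultimately show ?thesis
    using word_prod_r_pos[of "butlast w"] r_less_1[OF last] by simp
qed

lemma finite_words_bounded_below:
  assumes "0 < \<rho>"
  shows "finite {w \<in> lists {1..N}. \<rho> \<le> word_prod r w}"
proof -
  define m where "m = Max (r ` {1..N})"
  have le_m: "r i \<le> m" if "i \<in> {1..N}" for i
    unfolding m_def using that by simp
  have "m \<in> r ` {1..N}"
    unfolding m_def using N_pos by (intro Max_in) auto
  then have "0 < m" "m < 1" using r_pos r_less_1 by auto
  obtain L where L: "m ^ L < \<rho>"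
    using real_arch_pow_inv[OF assms \<open>m < 1\<close>] by blast
  have le_pow: "word_prod r w \<le> m ^ length w" if "w \<in> lists {1..N}" for w
    using that
  proof (induction w)
    case (Cons i w)
    then have "r i * word_prod r w \<le> m * m ^ length w"
      using le_m[of i] \<open>0 < m\<close> word_prod_r_pos[of w] by (intro mult_mono) auto
    then show ?case by (simp add: word_prod_def)
  qed (simp add: word_prod_def)
  have "length w \<le> L" if "w \<in> lists {1..N}" "\<rho> \<le> word_prod r w" for w
  proof (rule ccontr)
    assume "\<not> length w \<le> L"
    then have "m ^ length w \<le> m ^ L"
      using \<open>0 < m\<close> \<open>m < 1\<close> by (intro power_decreasing) auto
    with le_pow[OF that(1)] that(2) L show False by simp
  qed
  then have "{w \<in> lists {1..N}. \<rho> \<le> word_prod r w} \<subseteq> {w. set w \<subseteq> {1..N} \<and> length w \<le> L}"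
    by auto
  then show ?thesis
    by (rule finite_subset) (simp add: finite_lists_length_le)
qed

lemma finite_long_words: "0 < \<rho> \<Longrightarrow> finite (long_words N r \<rho>)"
  by (rule finite_subset[OF _ finite_words_bounded_below[of \<rho>]])
    (auto simp: long_words_def words_def)

lemma finite_child_words:
  assumes "0 < \<rho>"
  shows "finite {w \<in> words N. \<rho> \<le> word_prod r (butlast w)}"
proof (rule finite_subset)
  let ?V = "{v \<in> lists {1..N}. \<rho> \<le> word_prod r v}"
  show "{w \<in> words N. \<rho> \<le> word_prod r (butlast w)} \<subseteq> (\<lambda>(v, i). v @ [i]) ` (?V \<times> {1..N})"
  proof
    fix w assume w: "w \<in> {w \<in> words N. \<rho> \<le> word_prod r (butlast w)}"
    then have "w = (\<lambda>(v, i). v @ [i]) (butlast w, last w)"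
      and "(butlast w, last w) \<in> ?V \<times> {1..N}"
      using last_in_set[of w]
      by (auto simp: words_def simp del: atLeastAtMost_iff dest: in_set_butlastD)
    then show "w \<in> (\<lambda>(v, i). v @ [i]) ` (?V \<times> {1..N})" by (rule image_eqI)
  qed
  show "finite ((\<lambda>(v, i). v @ [i]) ` (?V \<times> {1..N}))"
    using finite_words_bounded_below[OF assms] by auto
qed

lemma finite_cut_words: "0 < \<rho> \<Longrightarrow> finite (cut_words N r \<rho>)"
  by (rule finite_subset[OF _ finite_child_words[of \<rho>]]) (auto simp: cut_words_def)

text \<open>Together with the empty word, the long words form a finite tree, as passing to a parent only
  increases \<open>r\<^sub>w\<close>. Its non-empty nodes and the cut words just outside it are exactly the children
  of its nodes, and summing a multiplicative weight over all children multiplies the sum over the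
  nodes by the total weight of the letters.\<close>

lemma renewal_identity:
  fixes f :: "nat \<Rightarrow> 'b::comm_semiring_1"
  assumes \<rho>: "0 < \<rho>" "\<rho> < 1"
  shows "(\<Sum>w\<in>cut_words N r \<rho>. prod_list (map f w)) + (\<Sum>w\<in>long_words N r \<rho>. prod_list (map f w)) =
    (\<Sum>i=1..N. f i) * (1 + (\<Sum>w\<in>long_words N r \<rho>. prod_list (map f w)))"
proof -
  let ?V = "insert [] (long_words N r \<rho>)"
  have children: "{w. w \<in> words N \<and> butlast w \<in> ?V} = cut_words N r \<rho> \<union> long_words N r \<rho>" (is "?L = ?R")
  proof (rule set_eqI)
    fix w
    show "w \<in> ?L \<longleftrightarrow> w \<in> ?R"
    proof (cases "w \<in> words N")
      case True
      have "butlast w = [] \<Longrightarrow> word_prod r (butlast w) = 1" by (simp add: word_prod_def)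
      moreover have "butlast w \<in> words N \<longleftrightarrow> butlast w \<noteq> []"
        using True by (auto simp: words_def dest: in_set_butlastD)
      ultimately show ?thesis
        using True \<rho> word_prod_butlast_greater[OF True]
        by (auto simp: cut_words_def long_words_def)
    qed (auto simp: cut_words_def long_words_def)
  qed
  have "(\<Sum>w\<in>cut_words N r \<rho>. prod_list (map f w)) + (\<Sum>w\<in>long_words N r \<rho>. prod_list (map f w)) =
    (\<Sum>w | w \<in> words N \<and> butlast w \<in> ?V. prod_list (map f w))"
    unfolding children
    by (rule sum.union_disjoint[symmetric])
      (use \<rho> finite_cut_words finite_long_words in \<open>auto simp: cut_words_def long_words_def\<close>)
  also have "\<dots> = (\<Sum>i=1..N. f i) * (\<Sum>v\<in>?V. prod_list (map f v))"
    by (rule sum_children) (auto simp: long_words_def words_def)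
  also have "(\<Sum>v\<in>?V. prod_list (map f v)) = 1 + (\<Sum>w\<in>long_words N r \<rho>. prod_list (map f w))"
    using finite_long_words \<rho> by (subst sum.insert) (auto simp: long_words_def words_def)
  finally show ?thesis .
qed

end

lemma word_prod_powr:
  assumes "\<And>i. i \<in> set w \<Longrightarrow> 0 < x i"
  shows "word_prod (\<lambda>i. x i powr y) w = word_prod x w powr y"
  using assms
proof (induction w)
  case (Cons i w)
  then show ?case
    using word_prod_pos[of w x] by (simp add: word_prod_def powr_mult)
qed (simp add: word_prod_def)

lemma word_prod_mult: "word_prod (\<lambda>i. x i * y i) w = word_prod x w * word_prod y w"
  by (induction w) (simp_all add: word_prod_def mult_ac)

text \<open>The two sums in \<open>C_sym\<close> together run over all cut words, so the renewal identity evaluates their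
  total. The words with \<open>r\<close>-value of the
  parent equal to \<open>\<rho>\<close> are the children of the words at level \<open>\<rho>\<close>, so their sum is \<open>\<sigma>\<close> times the sum
  over that level, and the average of \<open>1\<close> and \<open>1 / \<sigma>\<close> in \<open>C_sym\<close> turns it into a term
  proportional to \<open>\<sigma> - 1\<close>.\<close>

lemma C_sym_eq:
  fixes d :: nat and q :: real
  assumes "ratio_list N r" and p_pos: "\<And>i. i \<in> {1..N} \<Longrightarrow> 0 < p i" and \<rho>: "0 < \<rho>" "\<rho> < 1"
  defines "u \<equiv> \<lambda>l. real l - real d * q"
  shows "C_sym N p r d q l \<rho> =
    sigma_ql N p r d q l
    + (sigma_ql N p r d q l - 1) * (\<Sum>w\<in>long_words N r \<rho>. word_prod p w powr q * word_prod r w powr u l)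
    - (sigma_ql N p r d q l - 1) / 2 *
      (\<rho> powr u l * (\<Sum>w | w \<in> words N \<and> word_prod r w = \<rho>. word_prod p w powr q))"
proof -
  interpret ratio_list N r by fact
  define f where "f i = p i powr q * r i powr u l" for i
  define b where "b w = word_prod p w powr q * word_prod r w powr u l" for w
  define \<sigma> where "\<sigma> = sigma_ql N p r d q l"
  have \<sigma>_eq: "\<sigma> = (\<Sum>i=1..N. f i)"
    by (simp add: \<sigma>_def sigma_ql_def f_def u_def)
  have "0 < \<sigma>"
    unfolding \<sigma>_eq f_def using N_pos p_pos r_pos
    by (intro sum_pos mult_pos_pos) (auto simp: order_less_imp_not_eq2)
  have f_b: "prod_list (map f w) = b w" if "w \<in> words N" for w
  proof -
    have "word_prod f w = b w"
      unfolding f_def b_def word_prod_mult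
      using that p_pos r_pos by (subst (1 2) word_prod_powr) (auto simp: words_def)
    then show ?thesis by (simp add: word_prod_def)
  qed
  have sum_b: "(\<Sum>w\<in>A. prod_list (map f w)) = (\<Sum>w\<in>A. b w)" if "A \<subseteq> words N" for A
    using f_b that by (intro sum.cong) auto
  define X where "X = (\<Sum>w | w \<in> words N \<and> word_prod r w < \<rho> \<and> \<rho> < word_prod r (butlast w). b w)"
  define Y where "Y = (\<Sum>w | w \<in> words N \<and> \<rho> = word_prod r (butlast w). b w)"
  define D where "D = (\<Sum>w | w \<in> words N \<and> word_prod r w = \<rho>. b w)"
  define W where "W = (\<Sum>w\<in>long_words N r \<rho>. b w)"
  have "X + Y = (\<Sum>w\<in>cut_words N r \<rho>. b w)"
  proof -
    have "cut_words N r \<rho> = {w. w \<in> words N \<and> word_prod r w < \<rho> \<and> \<rho> < word_prod r (butlast w)}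
        \<union> {w. w \<in> words N \<and> \<rho> = word_prod r (butlast w)}" (is "_ = ?A \<union> ?B")
      using word_prod_butlast_greater by (auto simp: cut_words_def)
    moreover from this have "finite ?A" "finite ?B"
      using finite_cut_words[OF \<rho>(1)] by simp_all
    moreover have "?A \<inter> ?B = {}" by auto
    ultimately show ?thesis by (simp add: X_def Y_def sum.union_disjoint)
  qed
  moreover have "(\<Sum>w\<in>cut_words N r \<rho>. b w) + W = \<sigma> * (1 + W)"
    using renewal_identity[OF \<rho>, of f]
    by (simp add: sum_b W_def \<sigma>_eq cut_words_def long_words_def)
  ultimately have renewal: "X + Y = \<sigma> + (\<sigma> - 1) * W" by (simp add: algebra_simps)
  have "Y = \<sigma> * D"
  proof -
    let ?V = "{v. v \<in> words N \<and> word_prod r v = \<rho>}"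
    have "{w. w \<in> words N \<and> \<rho> = word_prod r (butlast w)} = {w. w \<in> words N \<and> butlast w \<in> ?V}"
    proof (rule Collect_cong, rule conj_cong[OF refl])
      fix w assume w: "w \<in> words N"
      have "butlast w = [] \<Longrightarrow> word_prod r (butlast w) = 1" by (simp add: word_prod_def)
      moreover have "butlast w \<in> words N \<longleftrightarrow> butlast w \<noteq> []"
        using w by (auto simp: words_def dest: in_set_butlastD)
      ultimately show "\<rho> = word_prod r (butlast w) \<longleftrightarrow> butlast w \<in> ?V"
        using \<rho> by auto
    qed
    then have "Y = (\<Sum>w | w \<in> words N \<and> butlast w \<in> ?V. prod_list (map f w))"
      by (subst sum_b) (auto simp: Y_def)
    also have "\<dots> = \<sigma> * (\<Sum>v\<in>?V. prod_list (map f v))"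
      unfolding \<sigma>_eq by (rule sum_children) (auto simp: words_def)
    also have "\<dots> = \<sigma> * D" by (subst sum_b) (auto simp: D_def)
    finally show ?thesis .
  qed
  have "C_sym N p r d q l \<rho> = X + (1 + 1 / \<sigma>) / 2 * Y"
    by (simp add: C_sym_def X_def Y_def \<sigma>_def b_def u_def)
  also have "\<dots> = X + Y - (\<sigma> - 1) / 2 * D"
    using \<open>0 < \<sigma>\<close> \<open>Y = \<sigma> * D\<close> by (simp add: field_simps)
  also have "\<dots> = \<sigma> + (\<sigma> - 1) * W - (\<sigma> - 1) / 2 * D" by (simp add: renewal)
  also have "D = \<rho> powr u l * (\<Sum>w | w \<in> words N \<and> word_prod r w = \<rho>. word_prod p w powr q)"
    unfolding D_def sum_distrib_left by (rule sum.cong) (auto simp: b_def)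
  finally show ?thesis by (simp add: \<sigma>_def W_def b_def)
qed

text \<open>In \<open>V_sym\<close> the factor \<open>\<rho> powr u l\<close> of the level term cancels, and what remains of it does not depend
  on \<open>l\<close> apart from the factor \<open>\<kappa> l * (\<sigma> l - 1)\<close>; these sum to zero by consistency.\<close>

lemma V_sym_eq:
  fixes d :: nat and q :: real
  assumes "ratio_list N r" and p_pos: "\<And>i. i \<in> {1..N} \<Longrightarrow> 0 < p i" and \<rho>: "0 < \<rho>" "\<rho> < 1"
    and consistent: "(\<Sum>l=0..d. \<kappa> l * (sigma_ql N p r d q l - 1)) = 0"
  defines "u \<equiv> \<lambda>l. real l - real d * q"
  shows "V_sym N p r d \<kappa> q \<rho> =
    (\<Sum>l=0..d. \<kappa> l * (sigma_ql N p r d q l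
      + (sigma_ql N p r d q l - 1) * (\<Sum>w\<in>long_words N r \<rho>. word_prod p w powr q * word_prod r w powr u l))
      * \<rho> powr - u l)"
proof -
  define D where "D = (\<Sum>w | w \<in> words N \<and> word_prod r w = \<rho>. word_prod p w powr q)"
  define \<sigma> where "\<sigma> = sigma_ql N p r d q"
  define W where "W l = (\<Sum>w\<in>long_words N r \<rho>. word_prod p w powr q * word_prod r w powr u l)" for l
  have "\<kappa> l * C_sym N p r d q l \<rho> * \<rho> powr (- real l + real d * q) =
    \<kappa> l * (\<sigma> l + (\<sigma> l - 1) * W l) * \<rho> powr - u l - D / 2 * (\<kappa> l * (\<sigma> l - 1))" for l
  proof -
    have C: "C_sym N p r d q l \<rho> = \<sigma> l + (\<sigma> l - 1) * W l - (\<sigma> l - 1) / 2 * (\<rho> powr u l * D)"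
      using C_sym_eq[where d = d and q = q and l = l, OF assms(1) p_pos \<rho>] by (simp only: D_def \<sigma>_def W_def u_def)
    have inv: "\<rho> powr u l * \<rho> powr - u l = 1"
      using \<rho> by (simp add: powr_minus)
    have exponent: "- real l + real d * q = - u l" by (simp add: u_def)
    have "\<kappa> l * C_sym N p r d q l \<rho> * \<rho> powr (- real l + real d * q) =
      \<kappa> l * (\<sigma> l + (\<sigma> l - 1) * W l) * \<rho> powr - u l
      - D / 2 * (\<kappa> l * (\<sigma> l - 1)) * (\<rho> powr u l * \<rho> powr - u l)"
      unfolding C exponent by (simp add: field_simps)
    then show ?thesis unfolding inv by simp
  qed
  then have "V_sym N p r d \<kappa> q \<rho> =
    (\<Sum>l=0..d. \<kappa> l * (\<sigma> l + (\<sigma> l - 1) * W l) * \<rho> powr - u l) - D / 2 * (\<Sum>l=0..d. \<kappa> l * (\<sigma> l - 1))"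
    unfolding V_sym_def by (simp add: sum_subtractf sum_distrib_left)
  with consistent show ?thesis by (simp add: \<sigma>_def W_def)
qed

section \<open>Residues in expanding squares\<close>

lemma contour_integral_square_bound:
  assumes t: "0 < t"
    and cont: "continuous_on (path_image (rectpath (Complex (-t) (-t)) (Complex t t))) f"
    and bound: "\<And>z. z \<in> path_image (rectpath (Complex (-t) (-t)) (Complex t t)) \<Longrightarrow> norm (f z) \<le> B"
  shows "norm (contour_integral (rectpath (Complex (-t) (-t)) (Complex t t)) f) \<le> 8 * t * B"
proof -
  let ?a = "Complex (-t) (-t)" and ?b = "Complex t (-t)" and ?c = "Complex t t" and ?d = "Complex (-t) t"
  have rect: "rectpath ?a ?c = linepath ?a ?b +++ linepath ?b ?c +++ linepath ?c ?d +++ linepath ?d ?a"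
    by (simp add: rectpath_def Let_def)
  have image: "path_image (rectpath ?a ?c) =
    closed_segment ?a ?b \<union> closed_segment ?b ?c \<union> closed_segment ?c ?d \<union> closed_segment ?d ?a"
    unfolding rect by (simp add: path_image_join Un_assoc)
  have integrable: "f contour_integrable_on linepath x y"
    if "closed_segment x y \<subseteq> path_image (rectpath ?a ?c)" for x y
    using continuous_on_subset[OF cont that] by (rule contour_integrable_continuous_linepath)
  have "0 \<le> B"
  proof -
    have "?a \<in> path_image (rectpath ?a ?c)" unfolding image by simp
    from order_trans[OF norm_ge_zero bound[OF this]] show ?thesis .
  qed
  have side: "norm (contour_integral (linepath x y) f) \<le> B * norm (y - x)"
    if "closed_segment x y \<subseteq> path_image (rectpath ?a ?c)" for x y
    by (rule contour_integral_bound_linepath[OF integrable[OF that] \<open>0 \<le> B\<close>], rule bound)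
      (use that in blast)
  let ?I = "\<lambda>x y. contour_integral (linepath x y) f"
  have sub: "closed_segment ?a ?b \<subseteq> path_image (rectpath ?a ?c)" "closed_segment ?b ?c \<subseteq> path_image (rectpath ?a ?c)"
     "closed_segment ?c ?d \<subseteq> path_image (rectpath ?a ?c)" "closed_segment ?d ?a \<subseteq> path_image (rectpath ?a ?c)"
    unfolding image by blast+
  note int = integrable[OF sub(1)] integrable[OF sub(2)] integrable[OF sub(3)] integrable[OF sub(4)]
  have "norm (contour_integral (rectpath ?a ?c) f) = norm (?I ?a ?b + (?I ?b ?c + (?I ?c ?d + ?I ?d ?a)))"
    unfolding rect
    by (simp add: int)
  also have "\<dots> \<le> norm (?I ?a ?b) + (norm (?I ?b ?c) + (norm (?I ?c ?d) + norm (?I ?d ?a)))"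
    by (rule norm_triangle_mono[OF order_refl norm_triangle_mono[OF order_refl norm_triangle_mono[OF order_refl order_refl]]])
  also have "\<dots> \<le> B * (2 * t) + (B * (2 * t) + (B * (2 * t) + B * (2 * t)))"
  proof -
    have "norm (?b - ?a) = 2 * t" "norm (?c - ?b) = 2 * t" "norm (?d - ?c) = 2 * t" "norm (?a - ?d) = 2 * t"
      using t by (simp_all add: cmod_def real_sqrt_mult)
    then show ?thesis
      using side[OF sub(1)] side[OF sub(2)] side[OF sub(3)] side[OF sub(4)]
      by (intro add_mono) simp_all
  qed
  finally show ?thesis by (simp add: algebra_simps)
qed

text \<open>The set \<open>P\<close> of singularities may be infinite. The residue theorem is applied in an open square
  slightly larger than the contour, which meets \<open>P\<close> in a finite set only; the singularities outside
  the contour contribute nothing because of their winding number.\<close>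

lemma sum_residues_square_bound:
  assumes t: "0 < t"
    and finite: "\<And>R. finite {z\<in>P. \<bar>Re z\<bar> \<le> R \<and> \<bar>Im z\<bar> \<le> R}"
    and holo: "f holomorphic_on - P"
    and bound: "\<And>z. max \<bar>Re z\<bar> \<bar>Im z\<bar> = t \<Longrightarrow> z \<notin> P \<and> norm (f z) \<le> B"
  shows "norm (\<Sum>z | z \<in> P \<and> \<bar>Re z\<bar> \<le> t \<and> \<bar>Im z\<bar> \<le> t. residue f z) \<le> 4 * t * B / pi"
proof -
  let ?g = "rectpath (Complex (-t) (-t)) (Complex t t)"
  let ?S = "box (Complex (-t-1) (-t-1)) (Complex (t+1) (t+1))"
  define Q where "Q = P \<inter> ?S"
  define Q1 where "Q1 = {z. z \<in> P \<and> \<bar>Re z\<bar> \<le> t \<and> \<bar>Im z\<bar> \<le> t}"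
  have image: "z \<in> path_image ?g \<longleftrightarrow> max \<bar>Re z\<bar> \<bar>Im z\<bar> = t" for z
  proof -
    have "z \<in> path_image ?g \<longleftrightarrow>
      (Re z = -t \<or> Re z = t) \<and> -t \<le> Im z \<and> Im z \<le> t \<or> (Im z = -t \<or> Im z = t) \<and> -t \<le> Re z \<and> Re z \<le> t"
      using t by (simp add: path_image_rectpath conj_commute disj_commute)
    then show ?thesis using t by linarith
  qed
  have "finite Q"
    by (rule finite_subset[OF _ finite[of "t + 1"]]) (auto simp: Q_def in_box_complex_iff)
  have "Q1 \<subseteq> Q" by (auto simp: Q_def Q1_def in_box_complex_iff)
  have holo_S: "f holomorphic_on ?S - Q"
    by (rule holomorphic_on_subset[OF holo]) (auto simp: Q_def)
  have path: "path_image ?g \<subseteq> ?S - Q"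
  proof
    fix z assume "z \<in> path_image ?g"
    then have z: "max \<bar>Re z\<bar> \<bar>Im z\<bar> = t" by (simp add: image)
    then have "z \<in> ?S"
      unfolding in_box_complex_iff complex.sel greaterThanLessThan_iff by linarith
    with bound[OF z] show "z \<in> ?S - Q" by (simp add: Q_def)
  qed
  have wn_out: "winding_number ?g z = 0" if "\<not> (\<bar>Re z\<bar> \<le> t \<and> \<bar>Im z\<bar> \<le> t)" for z
    using that t by (intro winding_number_rectpath_outside) (auto simp: in_cbox_complex_iff)
  have wn_in: "winding_number ?g z = 1" if "z \<in> Q1" for z
  proof (rule winding_number_rectpath)
    have "max \<bar>Re z\<bar> \<bar>Im z\<bar> \<noteq> t" using that bound by (auto simp: Q1_def)
    then show "z \<in> box (Complex (-t) (-t)) (Complex t t)"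
      using that by (simp add: Q1_def in_box_complex_iff) linarith
  qed
  have "contour_integral ?g f = 2 * pi * \<i> * (\<Sum>z\<in>Q. winding_number ?g z * residue f z)"
  proof (rule Residue_theorem[OF _ _ \<open>finite Q\<close> holo_S _ _ path])
    show "\<forall>z. z \<notin> ?S \<longrightarrow> winding_number ?g z = 0"
    proof (intro allI impI)
      fix z assume "z \<notin> ?S"
      then show "winding_number ?g z = 0"
        by (intro wn_out) (auto simp: in_box_complex_iff)
    qed
  qed (auto intro: convex_connected)
  also have "(\<Sum>z\<in>Q. winding_number ?g z * residue f z) = (\<Sum>z\<in>Q1. winding_number ?g z * residue f z)"
    using \<open>finite Q\<close> \<open>Q1 \<subseteq> Q\<close>
    by (intro sum.mono_neutral_right) (auto simp: wn_out Q_def Q1_def)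
  also have "\<dots> = (\<Sum>z\<in>Q1. residue f z)" by (simp add: wn_in)
  finally have "norm (contour_integral ?g f) = 2 * pi * norm (\<Sum>z\<in>Q1. residue f z)"
    by (simp add: norm_mult)
  moreover have "norm (contour_integral ?g f) \<le> 8 * t * B"
  proof (rule contour_integral_square_bound[OF t])
    show "continuous_on (path_image ?g) f"
      by (rule continuous_on_subset[OF holomorphic_on_imp_continuous_on[OF holo_S] path])
    show "norm (f z) \<le> B" if "z \<in> path_image ?g" for z
      using bound that by (simp add: image)
  qed
  ultimately show ?thesis
    unfolding Q1_def[symmetric] by (subst pos_le_divide_eq) (auto simp: mult_ac)
qed

lemma sum_residues_expanding_squares_tendsto_0:
  fixes t :: "nat \<Rightarrow> real"
  assumes t: "filterlim t at_top sequentially"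
    and finite: "\<And>R. finite {z\<in>P. \<bar>Re z\<bar> \<le> R \<and> \<bar>Im z\<bar> \<le> R}"
    and holo: "f holomorphic_on - P"
    and bound: "\<forall>\<^sub>F n in sequentially. \<forall>z. max \<bar>Re z\<bar> \<bar>Im z\<bar> = t n \<longrightarrow> z \<notin> P \<and> norm (f z) \<le> M / (t n)\<^sup>2"
  shows "(\<lambda>n. \<Sum>z | z \<in> P \<and> \<bar>Re z\<bar> \<le> t n \<and> \<bar>Im z\<bar> \<le> t n. residue f z) \<longlonglongrightarrow> 0"
proof (rule Lim_null_comparison)
  have "\<forall>\<^sub>F n in sequentially. 0 < t n"
    using t by (rule filterlim_at_top_dense[THEN iffD1, rule_format])
  with bound show "\<forall>\<^sub>F n in sequentially.
    norm (\<Sum>z | z \<in> P \<and> \<bar>Re z\<bar> \<le> t n \<and> \<bar>Im z\<bar> \<le> t n. residue f z) \<le> (4 * M / pi) / t n"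
  proof eventually_elim
    case (elim n)
    have "norm (\<Sum>z | z \<in> P \<and> \<bar>Re z\<bar> \<le> t n \<and> \<bar>Im z\<bar> \<le> t n. residue f z)
        \<le> 4 * t n * (M / (t n)\<^sup>2) / pi"
      using elim(1) by (intro sum_residues_square_bound[OF elim(2) finite holo]) blast
    also have "\<dots> = (4 * M / pi) / t n"
      using elim(2) by (simp add: power2_eq_square)
    finally show ?case .
  qed
  show "(\<lambda>n. (4 * M / pi) / t n) \<longlonglongrightarrow> 0"
    by (rule real_tendsto_divide_at_top[OF tendsto_const t])
qed

text \<open>Subtracting \<open>(\<Sum>l\<in>L. c l) / s = 0\<close> cancels the leading term of the expansion at infinity:
  \<open>c / (s - u) - c / s = c u / (s (s - u))\<close>.\<close>

lemma sum_simple_fractions_bound: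
  fixes c u :: "'i \<Rightarrow> complex"
  assumes "finite L" and "(\<Sum>l\<in>L. c l) = 0"
  obtains M R where "0 < R" and "0 \<le> M" and "\<And>s. R \<le> norm s \<Longrightarrow> norm (\<Sum>l\<in>L. c l / (s - u l)) \<le> M / (norm s)\<^sup>2"
proof
  define R where "R = 1 + 2 * (\<Sum>l\<in>L. norm (u l))"
  define M where "M = (\<Sum>l\<in>L. 2 * norm (c l * u l))"
  show "0 < R" unfolding R_def by (intro add_pos_nonneg mult_nonneg_nonneg sum_nonneg) auto
  show "0 \<le> M" unfolding M_def by (intro sum_nonneg) auto
  fix s :: complex assume s: "R \<le> norm s"
  with \<open>0 < R\<close> have "0 < norm s" by linarith
  then have "s \<noteq> 0" by auto
  have far: "norm s / 2 \<le> norm (s - u l)" "s - u l \<noteq> 0" if "l \<in> L" for l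
  proof -
    have "norm (u l) \<le> (\<Sum>l\<in>L. norm (u l))" using assms that by (intro member_le_sum) auto
    with s have "2 * norm (u l) \<le> norm s" by (simp add: R_def)
    moreover have "norm s - norm (u l) \<le> norm (s - u l)" by (rule norm_triangle_ineq2)
    ultimately show "norm s / 2 \<le> norm (s - u l)" by simp
    with \<open>0 < norm s\<close> have "0 < norm (s - u l)" by linarith
    then show "s - u l \<noteq> 0" by simp
  qed
  have "(\<Sum>l\<in>L. c l / (s - u l)) = (\<Sum>l\<in>L. c l / (s - u l)) - (\<Sum>l\<in>L. c l) / s"
    by (simp add: assms)
  also have "\<dots> = (\<Sum>l\<in>L. c l * u l / (s * (s - u l)))"
    unfolding sum_divide_distrib sum_subtractf[symmetric]
    using far \<open>s \<noteq> 0\<close> by (intro sum.cong) (auto simp: field_simps)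
  also have "norm \<dots> \<le> (\<Sum>l\<in>L. 2 * norm (c l * u l) / (norm s)\<^sup>2)"
  proof (rule sum_norm_le)
    fix l assume l: "l \<in> L"
    have "norm (c l * u l / (s * (s - u l))) = norm (c l * u l) / (norm s * norm (s - u l))"
      by (simp add: norm_divide norm_mult)
    also have "\<dots> \<le> norm (c l * u l) / (norm s * (norm s / 2))"
      using far[OF l] \<open>0 < norm s\<close> by (intro divide_left_mono mult_left_mono mult_pos_pos) auto
    finally show "norm (c l * u l / (s * (s - u l))) \<le> 2 * norm (c l * u l) / (norm s)\<^sup>2"
      by (simp add: power2_eq_square mult_ac)
  qed
  also have "\<dots> = M / (norm s)\<^sup>2" by (simp add: M_def sum_divide_distrib)
  finally show "norm (\<Sum>l\<in>L. c l / (s - u l)) \<le> M / (norm s)\<^sup>2" .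
qed

section \<open>The zeta-function\<close>

lemma powr_tendsto_0_at_top:
  fixes x :: real
  assumes "0 < x" "x < 1"
  shows "((\<lambda>y. x powr y) \<longlongrightarrow> 0) at_top"
proof -
  have "filterlim (\<lambda>y. ln x * y) at_bot at_top"
    using assms by (intro filterlim_tendsto_neg_mult_at_bot[OF tendsto_const]) (auto simp: filterlim_ident)
  then have "((\<lambda>y. exp (ln x * y)) \<longlongrightarrow> 0) at_top"
    by (rule filterlim_compose[OF exp_at_bot])
  then show ?thesis using assms by (simp add: powr_def mult.commute)
qed

lemma norm_weighted_powr:
  "0 \<le> c \<Longrightarrow> 0 < x \<Longrightarrow> norm (complex_of_real c * complex_of_real x powr s) = c * x powr Re s"
  by (simp add: norm_mult norm_powr_real_powr)

text \<open>The exponent \<open>q\<close> enters the zeta-function only through the weights \<open>p\<^sub>i\<^sup>q\<close>; in their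
  place there are arbitrary positive weights \<open>a\<^sub>i\<close>.\<close>

locale weighted_ratio_list = ratio_list +
  fixes a :: "nat \<Rightarrow> real"
  assumes a_pos: "\<And>i. i \<in> {1..N} \<Longrightarrow> 0 < a i"
begin

definition letter_sum :: "complex \<Rightarrow> complex" where
  "letter_sum s = (\<Sum>i=1..N. complex_of_real (a i) * complex_of_real (r i) powr s)"

definition zeta :: "complex \<Rightarrow> complex" where
  "zeta s = letter_sum s / (1 - letter_sum s)"

definition word_sum :: "nat list set \<Rightarrow> complex \<Rightarrow> complex" where
  "word_sum V s = (\<Sum>w\<in>V. complex_of_real (word_prod a w) * complex_of_real (word_prod r w) powr s)"

lemma letter_sum_of_real: "letter_sum (complex_of_real x) = complex_of_real (\<Sum>i=1..N. a i * r i powr x)"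
  using r_pos by (simp add: letter_sum_def powr_of_real less_imp_le)

lemma holomorphic_letter_sum [holomorphic_intros]: "letter_sum holomorphic_on A"
  unfolding letter_sum_def by (intro holomorphic_intros)

lemma norm_letter_sum_le: "norm (letter_sum s) \<le> (\<Sum>i=1..N. a i * r i powr Re s)"
  unfolding letter_sum_def using a_pos r_pos
  by (intro sum_norm_le) (simp add: norm_weighted_powr less_imp_le)

lemma letter_sum_small_on_right:
  obtains C where "0 < C" and "\<And>s. C \<le> Re s \<Longrightarrow> norm (letter_sum s) \<le> 1 / 2"
proof -
  have "((\<lambda>x. \<Sum>i=1..N. a i * r i powr x) \<longlongrightarrow> (\<Sum>i=1..N. a i * 0)) at_top"
    using r_pos r_less_1 by (intro tendsto_intros powr_tendsto_0_at_top) auto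
  then have "\<forall>\<^sub>F x in at_top. (\<Sum>i=1..N. a i * r i powr x) < 1 / 2"
    by (rule order_tendstoD) simp
  then obtain C where C: "\<And>x. C \<le> x \<Longrightarrow> (\<Sum>i=1..N. a i * r i powr x) < 1 / 2"
    by (auto simp: eventually_at_top_linorder)
  have "norm (letter_sum s) \<le> 1 / 2" if "max 1 C \<le> Re s" for s
    using norm_letter_sum_le[of s] C[of "Re s"] that by simp
  then show thesis by (intro that[of "max 1 C"]) auto
qed

text \<open>As \<open>Re s\<close> decreases to \<open>-\<infinity>\<close>, the smallest ratio \<open>m\<close> dominates. All its terms have the same
  phase \<open>m powr s\<close>, so they add up without cancellation, and the other terms are
  negligible relative to them.\<close>

lemma letter_sum_large_on_left:
  obtains C where "C < 0" and "\<And>s. Re s \<le> C \<Longrightarrow> 2 \<le> norm (letter_sum s)"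
proof -
  define m where "m = Min (r ` {1..N})"
  define I where "I = {i\<in>{1..N}. r i = m}"
  define J where "J = {i\<in>{1..N}. r i \<noteq> m}"
  define A where "A = (\<Sum>i\<in>I. a i)"
  have m_in: "m \<in> r ` {1..N}"
    unfolding m_def using N_pos by (intro Min_in) auto
  then have "0 < m" "m < 1" using r_pos r_less_1 by auto
  have "I \<noteq> {}" using m_in by (auto simp: I_def)
  then have "0 < A" unfolding A_def using a_pos by (intro sum_pos) (auto simp: I_def)
  have m_less: "m < r i" if "i \<in> J" for i
  proof -
    have "m \<le> r i" unfolding m_def using that by (intro Min_le) (auto simp: J_def)
    with that show ?thesis by (auto simp: J_def)
  qed
  have norm_ge: "m powr Re s * (A - (\<Sum>i\<in>J. a i * (m / r i) powr - Re s)) \<le> norm (letter_sum s)" for s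
  proof -
    let ?z = "\<lambda>i. complex_of_real (a i) * complex_of_real (r i) powr s"
    have "letter_sum s = sum ?z I + sum ?z J"
      unfolding letter_sum_def I_def J_def
      by (subst sum.union_disjoint[symmetric]) (auto intro: sum.cong)
    moreover have "sum ?z I = complex_of_real A * complex_of_real m powr s"
      unfolding A_def of_real_sum sum_distrib_right by (rule sum.cong) (auto simp: I_def)
    ultimately have letter_sum_eq: "letter_sum s = complex_of_real A * complex_of_real m powr s + sum ?z J" by simp
    have "norm (sum ?z J) \<le> (\<Sum>i\<in>J. m powr Re s * (a i * (m / r i) powr - Re s))"
    proof (rule sum_norm_le)
      fix i assume i: "i \<in> J"
      then have "0 < r i" "0 < a i" using r_pos a_pos by (auto simp: J_def)
      then have "m powr Re s * (a i * (m / r i) powr - Re s) = a i * r i powr Re s"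
        using \<open>0 < m\<close> by (simp add: powr_minus powr_divide field_simps)
      then show "norm (?z i) \<le> m powr Re s * (a i * (m / r i) powr - Re s)"
        using \<open>0 < r i\<close> \<open>0 < a i\<close> by (simp add: norm_weighted_powr)
    qed
    then have "norm (sum ?z J) \<le> m powr Re s * (\<Sum>i\<in>J. a i * (m / r i) powr - Re s)"
      by (simp add: sum_distrib_left)
    moreover have "norm (complex_of_real A * complex_of_real m powr s) = A * m powr Re s"
      using \<open>0 < A\<close> \<open>0 < m\<close> by (simp add: norm_weighted_powr)
    moreover have "norm (complex_of_real A * complex_of_real m powr s) \<le> norm (letter_sum s) + norm (sum ?z J)"
      using norm_triangle_ineq4[of "letter_sum s" "sum ?z J"] by (simp add: letter_sum_eq)
    ultimately show ?thesis by (simp add: algebra_simps)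
  qed
  have "((\<lambda>x. \<Sum>i\<in>J. a i * (m / r i) powr x) \<longlongrightarrow> (\<Sum>i\<in>J. a i * 0)) at_top"
    using \<open>0 < m\<close> m_less by (intro tendsto_intros powr_tendsto_0_at_top) (fastforce simp: divide_simps)+
  then have "\<forall>\<^sub>F x in at_top. (\<Sum>i\<in>J. a i * (m / r i) powr x) < A / 2"
    by (rule order_tendstoD) (use \<open>0 < A\<close> in simp)
  moreover have "\<forall>\<^sub>F x in at_top. m powr x < A / 4"
    by (rule order_tendstoD[OF powr_tendsto_0_at_top]) (use \<open>0 < A\<close> \<open>0 < m\<close> \<open>m < 1\<close> in auto)
  ultimately have "\<forall>\<^sub>F x in at_top. (\<Sum>i\<in>J. a i * (m / r i) powr x) < A / 2 \<and> m powr x < A / 4"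
    by (rule eventually_conj)
  then obtain D where D: "\<And>x. D \<le> x \<Longrightarrow> (\<Sum>i\<in>J. a i * (m / r i) powr x) < A / 2 \<and> m powr x < A / 4"
    by (auto simp: eventually_at_top_linorder)
  have "2 \<le> norm (letter_sum s)" if "Re s \<le> - max 1 D" for s
  proof -
    have "(\<Sum>i\<in>J. a i * (m / r i) powr - Re s) < A / 2" and small: "m powr - Re s < A / 4"
      using D[of "- Re s"] that by auto
    then have "m powr Re s * (A / 2) \<le> m powr Re s * (A - (\<Sum>i\<in>J. a i * (m / r i) powr - Re s))"
      by (intro mult_left_mono) auto
    also note norm_ge[of s]
    finally have "m powr Re s * (A / 2) \<le> norm (letter_sum s)" .
    moreover have "4 \<le> m powr Re s * A"
      using small \<open>0 < m\<close> by (simp add: powr_minus field_simps)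
    ultimately show ?thesis by simp
  qed
  then show thesis by (intro that[of "- max 1 D"]) auto
qed

text \<open>The letter sum is entire and not constant, as its size differs on the far left and
  the far right.\<close>

lemma finite_letter_sum_eq_1: "finite {z. letter_sum z = 1 \<and> \<bar>Re z\<bar> \<le> R \<and> \<bar>Im z\<bar> \<le> R}"
proof -
  obtain C where "C < 0" and C: "\<And>s. Re s \<le> C \<Longrightarrow> 2 \<le> norm (letter_sum s)" by (rule letter_sum_large_on_left) blast
  obtain D where "0 < D" and D: "\<And>s. D \<le> Re s \<Longrightarrow> norm (letter_sum s) \<le> 1 / 2" by (rule letter_sum_small_on_right) blast
  have "\<not> (\<lambda>z. letter_sum z - 1) constant_on UNIV"
  proof
    assume "(\<lambda>z. letter_sum z - 1) constant_on UNIV"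
    then have "letter_sum (of_real C) = letter_sum (of_real D)" unfolding constant_on_def by (metis UNIV_I diff_add_cancel)
    with C[of "of_real C"] D[of "of_real D"] show False by simp
  qed
  then have "finite {z\<in>cbox (Complex (-R) (-R)) (Complex R R). letter_sum z - 1 = 0}"
    by (intro holomorphic_compact_finite_zeros[of _ UNIV]) (auto intro!: holomorphic_intros)
  then show ?thesis
    by (rule rev_finite_subset) (auto simp: in_cbox_complex_iff)
qed

lemma letter_sum_neq_1_near: "\<forall>\<^sub>F w in at z. letter_sum w \<noteq> 1"
proof -
  define Q where "Q = {w. letter_sum w = 1 \<and> \<bar>Re w\<bar> \<le> norm z + 1 \<and> \<bar>Im w\<bar> \<le> norm z + 1} - {z}"
  have "open (ball z 1 - Q)" "z \<in> ball z 1 - Q"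
    using finite_letter_sum_eq_1[of "norm z + 1"] by (auto simp: Q_def intro!: open_Diff finite_imp_closed)
  then have "\<forall>\<^sub>F w in at z. w \<in> ball z 1 - Q" by (rule eventually_at_in_open')
  moreover have "\<forall>\<^sub>F w in at z. w \<noteq> z" by (rule eventually_neq_at_within)
  ultimately show ?thesis
  proof eventually_elim
    case (elim w)
    have "norm w \<le> norm z + 1"
      using elim norm_triangle_ineq2[of w z] by (simp add: dist_norm norm_minus_commute)
    then have "\<bar>Re w\<bar> \<le> norm z + 1" "\<bar>Im w\<bar> \<le> norm z + 1"
      using abs_Re_le_cmod[of w] abs_Im_le_cmod[of w] by linarith+
    with elim show ?case by (auto simp: Q_def)
  qed
qed

lemma is_pole_zeta_iff: "is_pole zeta z \<longleftrightarrow> letter_sum z = 1"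
proof
  have cont: "isCont letter_sum z"
    using holomorphic_on_imp_continuous_on[OF holomorphic_letter_sum[of UNIV]]
    by (simp add: continuous_on_eq_continuous_at)
  assume one: "letter_sum z = 1"
  have "((\<lambda>w. 1 - letter_sum w) \<longlongrightarrow> 1 - letter_sum z) (at z)"
    using cont by (intro tendsto_intros) (simp add: isCont_def)
  then have "filterlim (\<lambda>w. 1 - letter_sum w) (at 0) (at z)"
    unfolding filterlim_at using letter_sum_neq_1_near[of z] one by (auto elim: eventually_mono)
  then have "is_pole (\<lambda>w. letter_sum w / (1 - letter_sum w)) z"
    using one by (intro is_pole_divide[OF cont]) auto
  then show "is_pole zeta z" by (simp add: zeta_def[abs_def])
next
  assume pole: "is_pole zeta z"
  show "letter_sum z = 1"
  proof (rule ccontr)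
    assume "letter_sum z \<noteq> 1"
    have "open {w. letter_sum w \<noteq> 1}"
      using holomorphic_on_imp_continuous_on[OF holomorphic_letter_sum[of UNIV]]
      by (intro open_Collect_neq continuous_on_const)
    moreover have "zeta holomorphic_on {w. letter_sum w \<noteq> 1}"
      unfolding zeta_def by (intro holomorphic_intros) auto
    ultimately show False
      using not_is_pole_holomorphic[of "{w. letter_sum w \<noteq> 1}" z zeta] \<open>letter_sum z \<noteq> 1\<close> pole by simp
  qed
qed

lemma prod_list_letters:
  "w \<in> lists {1..N} \<Longrightarrow>
    prod_list (map (\<lambda>i. complex_of_real (a i) * complex_of_real (r i) powr s) w) =
    complex_of_real (word_prod a w) * complex_of_real (word_prod r w) powr s"
proof (induction w)
  case (Cons i w)
  then have "0 < r i" "0 < word_prod r w" using r_pos word_prod_r_pos by auto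
  then have "(complex_of_real (r i) * complex_of_real (word_prod r w)) powr s =
    complex_of_real (r i) powr s * complex_of_real (word_prod r w) powr s"
    by (intro powr_times_real) auto
  with Cons show ?case by (simp add: word_prod_def)
qed (simp add: word_prod_def)

text \<open>The tail of the series over words that defines \<open>zeta\<close> where it converges, in closed form wherever
  \<open>zeta\<close> is finite.\<close>

lemma zeta_minus_word_sum:
  assumes "0 < \<rho>" "\<rho> < 1" "letter_sum s \<noteq> 1"
  shows "zeta s - word_sum (long_words N r \<rho>) s = word_sum (cut_words N r \<rho>) s / (1 - letter_sum s)"
proof -
  let ?f = "\<lambda>i. complex_of_real (a i) * complex_of_real (r i) powr s"
  have word_sum: "word_sum V s = (\<Sum>w\<in>V. prod_list (map ?f w))" if "V \<subseteq> words N" for V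
    unfolding word_sum_def
    using that by (intro sum.cong refl prod_list_letters[symmetric] words_in_lists) blast
  have "word_sum (cut_words N r \<rho>) s + word_sum (long_words N r \<rho>) s =
    letter_sum s * (1 + word_sum (long_words N r \<rho>) s)"
    using renewal_identity[OF assms(1,2), of ?f]
    by (simp add: word_sum letter_sum_def cut_words_def long_words_def)
  then show ?thesis
    using assms(3) by (simp add: zeta_def field_simps)
qed

lemma norm_word_sum_scaled:
  assumes \<rho>: "0 < \<rho>" and V: "V \<subseteq> words N"
  shows "norm (complex_of_real \<rho> powr (- s) * word_sum V s) \<le>
    (\<Sum>w\<in>V. word_prod a w * (word_prod r w / \<rho>) powr Re s)"
  unfolding word_sum_def sum_distrib_left
proof (rule sum_norm_le)
  fix w assume "w \<in> V"
  then have w: "w \<in> lists {1..N}" using V words_in_lists by blast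
  then have "0 < word_prod a w" using a_pos by (intro word_prod_pos) auto
  have "norm (complex_of_real \<rho> powr (- s)) = \<rho> powr (- Re s)"
    using \<rho> by (simp add: norm_powr_real_powr)
  moreover have "(word_prod r w / \<rho>) powr Re s = \<rho> powr (- Re s) * word_prod r w powr Re s"
    using \<rho> word_prod_r_pos[OF w] by (simp add: powr_divide powr_minus_divide)
  ultimately show "norm (complex_of_real \<rho> powr (- s) * (complex_of_real (word_prod a w) * complex_of_real (word_prod r w) powr s))
     \<le> word_prod a w * (word_prod r w / \<rho>) powr Re s"
    using word_prod_r_pos[OF w] \<open>0 < word_prod a w\<close>
    by (simp add: norm_mult[of "complex_of_real \<rho> powr (- s)"] norm_weighted_powr)
qed

text \<open>On the right the two parts cancel to a large extent, and \<open>zeta_minus_word_sum\<close> shows the result: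
  cut words have \<open>word_prod r w / \<rho> < 1\<close>, so their scaled terms are at most \<open>word_prod a w\<close> when
  \<open>0 \<le> Re s\<close>.\<close>

lemma remainder_bounded_right:
  assumes \<rho>: "0 < \<rho>" "\<rho> < 1"
  obtains C K where "0 < C" and "\<And>s. C \<le> Re s \<Longrightarrow> letter_sum s \<noteq> 1"
    and "\<And>s. C \<le> Re s \<Longrightarrow>
      norm (complex_of_real \<rho> powr (- s) * (zeta s - word_sum (long_words N r \<rho>) s)) \<le> K"
proof -
  obtain C where "0 < C" and C: "\<And>s. C \<le> Re s \<Longrightarrow> norm (letter_sum s) \<le> 1 / 2" by (rule letter_sum_small_on_right) blast
  define K where "K = (\<Sum>w\<in>cut_words N r \<rho>. word_prod a w)"
  have "letter_sum s \<noteq> 1 \<and>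
    norm (complex_of_real \<rho> powr (- s) * (zeta s - word_sum (long_words N r \<rho>) s)) \<le> 2 * K"
    if s: "C \<le> Re s" for s
  proof
    show ne: "letter_sum s \<noteq> 1" using C[OF s] by auto
    have "norm (1::complex) - norm (letter_sum s) \<le> norm (1 - letter_sum s)" by (rule norm_triangle_ineq2)
    with C[OF s] have denom: "1 / 2 \<le> norm (1 - letter_sum s)" by simp
    have "norm (complex_of_real \<rho> powr (- s) * word_sum (cut_words N r \<rho>) s)
        \<le> (\<Sum>w\<in>cut_words N r \<rho>. word_prod a w * (word_prod r w / \<rho>) powr Re s)"
      by (rule norm_word_sum_scaled[OF \<rho>(1)]) (auto simp: cut_words_def)
    also have "\<dots> \<le> K"
      unfolding K_def
    proof (rule sum_mono)
      fix w assume w: "w \<in> cut_words N r \<rho>"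
      then have "w \<in> lists {1..N}" by (intro words_in_lists) (simp add: cut_words_def)
      then have pos: "0 < word_prod a w" "0 < word_prod r w"
        using a_pos word_prod_r_pos by (auto intro!: word_prod_pos)
      have "(word_prod r w / \<rho>) powr Re s \<le> 1"
        using w pos \<rho> s \<open>0 < C\<close> by (intro powr_le1) (auto simp: cut_words_def)
      with pos show "word_prod a w * (word_prod r w / \<rho>) powr Re s \<le> word_prod a w" by simp
    qed
    finally have num: "norm (complex_of_real \<rho> powr (- s) * word_sum (cut_words N r \<rho>) s) \<le> K" .
    then have "0 \<le> K" by (rule order_trans[OF norm_ge_zero])
    have "norm (complex_of_real \<rho> powr (- s) * (zeta s - word_sum (long_words N r \<rho>) s)) =
      norm (complex_of_real \<rho> powr (- s) * word_sum (cut_words N r \<rho>) s) / norm (1 - letter_sum s)"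
      by (simp add: zeta_minus_word_sum[OF \<rho> ne] norm_divide norm_mult)
    also have "\<dots> \<le> K / (1 / 2)"
      using num denom \<open>0 \<le> K\<close> by (intro frac_le) auto
    finally show "norm (complex_of_real \<rho> powr (- s) * (zeta s - word_sum (long_words N r \<rho>) s)) \<le> 2 * K"
      by simp
  qed
  with \<open>0 < C\<close> show thesis by (intro that[of C "2 * K"]) auto
qed

text \<open>On the left \<open>zeta\<close> and the word sum are bounded separately: the long words have
  \<open>1 \<le> word_prod r w / \<rho>\<close>, so their scaled terms are
  largest in norm at the right edge \<open>Re s = C\<close>.\<close>

lemma remainder_bounded_left:
  assumes \<rho>: "0 < \<rho>" "\<rho> < 1"
  shows "\<exists>K. \<forall>s. Re s \<le> C \<longrightarrow> norm (zeta s) \<le> k \<longrightarrow>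
    norm (complex_of_real \<rho> powr (- s) * (zeta s - word_sum (long_words N r \<rho>) s)) \<le> K"
proof (intro exI allI impI)
  fix s assume s: "Re s \<le> C" and k: "norm (zeta s) \<le> k"
  have "norm (complex_of_real \<rho> powr (- s) * zeta s) = \<rho> powr (- Re s) * norm (zeta s)"
    using \<rho> by (simp add: norm_mult norm_powr_real_powr)
  also have "\<dots> \<le> \<rho> powr (- C) * k"
    using s k \<rho> by (intro mult_mono powr_mono') auto
  finally have 1: "norm (complex_of_real \<rho> powr (- s) * zeta s) \<le> \<rho> powr (- C) * k" .
  have "norm (complex_of_real \<rho> powr (- s) * word_sum (long_words N r \<rho>) s)
      \<le> (\<Sum>w\<in>long_words N r \<rho>. word_prod a w * (word_prod r w / \<rho>) powr Re s)"
    by (rule norm_word_sum_scaled[OF \<rho>(1)]) (auto simp: long_words_def)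
  also have "\<dots> \<le> (\<Sum>w\<in>long_words N r \<rho>. word_prod a w * (word_prod r w / \<rho>) powr C)"
  proof (rule sum_mono)
    fix w assume w: "w \<in> long_words N r \<rho>"
    then have "w \<in> lists {1..N}" by (intro words_in_lists) (simp add: long_words_def)
    then have "0 < word_prod a w" using a_pos by (intro word_prod_pos) auto
    then show "word_prod a w * (word_prod r w / \<rho>) powr Re s \<le> word_prod a w * (word_prod r w / \<rho>) powr C"
      using w \<rho> s by (intro mult_left_mono powr_mono) (auto simp: long_words_def)
  qed
  finally have 2: "norm (complex_of_real \<rho> powr (- s) * word_sum (long_words N r \<rho>) s)
      \<le> (\<Sum>w\<in>long_words N r \<rho>. word_prod a w * (word_prod r w / \<rho>) powr C)" .
  show "norm (complex_of_real \<rho> powr (- s) * (zeta s - word_sum (long_words N r \<rho>) s))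
      \<le> \<rho> powr (- C) * k + (\<Sum>w\<in>long_words N r \<rho>. word_prod a w * (word_prod r w / \<rho>) powr C)"
    unfolding right_diff_distrib
    by (rule order_trans[OF norm_triangle_ineq4 add_mono[OF 1 2]])
qed

lemma zeta_bounded_on_left:
  obtains C where "C < 0" and "\<And>s. Re s \<le> C \<Longrightarrow> letter_sum s \<noteq> 1 \<and> norm (zeta s) \<le> 2"
proof -
  obtain C where "C < 0" and C: "\<And>s. Re s \<le> C \<Longrightarrow> 2 \<le> norm (letter_sum s)" by (rule letter_sum_large_on_left) blast
  have "letter_sum s \<noteq> 1 \<and> norm (zeta s) \<le> 2" if s: "Re s \<le> C" for s
  proof
    show "letter_sum s \<noteq> 1" using C[OF s] by auto
    have "norm (letter_sum s) - norm (1::complex) \<le> norm (letter_sum s - 1)" by (rule norm_triangle_ineq2)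
    then have "norm (letter_sum s) \<le> 2 * norm (1 - letter_sum s)" "0 < norm (1 - letter_sum s)"
      using C[OF s] by (simp_all only: norm_minus_commute[of 1] norm_one)
    then show "norm (zeta s) \<le> 2" by (simp add: zeta_def norm_divide divide_simps)
  qed
  with \<open>C < 0\<close> show thesis by (rule that)
qed

section \<open>The residue formula\<close>

text \<open>The integrand is \<open>H s = A s * B s\<close> with \<open>B s = \<rho> powr (- s) * (zeta s - W s)\<close>. Subtracting the entire
  function \<open>W\<close> does not change residues at the poles of \<open>zeta\<close>, but it makes \<open>B\<close> bounded on all four
  sides of the squares, including the right side, where \<open>\<rho> powr (- s) * zeta s\<close> by itself is
  unbounded as soon as some word satisfies \<open>\<rho> < r\<^sub>w\<close>.\<close>

lemma residue_sum_tendsto: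
  fixes L :: "'i set" and c u :: "'i \<Rightarrow> complex" and t :: "nat \<Rightarrow> real"
  defines "Z \<equiv> \<lambda>s. (\<Sum>l\<in>L. c l / (s - u l)) * zeta s"
  assumes L: "finite L" "inj_on u L"
    and c: "(\<Sum>l\<in>L. c l) = 0"
    and u: "\<And>l. l \<in> L \<Longrightarrow> letter_sum (u l) \<noteq> 1"
    and \<rho>: "0 < \<rho>" "\<rho> < 1"
    and t: "filterlim t at_top sequentially"
    and zeta_bound: "\<And>C. \<exists>k. \<forall>n s. Re s \<le> C \<longrightarrow> \<bar>Im s\<bar> = t n \<longrightarrow> letter_sum s \<noteq> 1 \<and> norm (zeta s) \<le> k"
  shows "(\<lambda>n. \<Sum>\<omega> | letter_sum \<omega> = 1 \<and> \<bar>Im \<omega>\<bar> \<le> t n. residue (\<lambda>s. Z s * complex_of_real \<rho> powr (- s)) \<omega>)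
    \<longlonglongrightarrow> (\<Sum>l\<in>L. - (c l * (complex_of_real \<rho> powr (- u l) *
      (zeta (u l) - word_sum (long_words N r \<rho>) (u l)))))"
proof -
  define A where "A = (\<lambda>s. \<Sum>l\<in>L. c l / (s - u l))"
  define W where "W = word_sum (long_words N r \<rho>)"
  define B where "B = (\<lambda>s. complex_of_real \<rho> powr (- s) * (zeta s - W s))"
  define H where "H = (\<lambda>s. A s * B s)"
  define P where "P = {z. letter_sum z = 1} \<union> u ` L"

  have open_neq: "open {z. letter_sum z \<noteq> 1}"
    using holomorphic_on_imp_continuous_on[OF holomorphic_letter_sum[of UNIV]]
    by (intro open_Collect_neq continuous_on_const)
  have holo_W: "W holomorphic_on X" for X
    unfolding W_def word_sum_def by (intro holomorphic_intros)
  have holo_zeta: "zeta holomorphic_on {z. letter_sum z \<noteq> 1}"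
    unfolding zeta_def by (intro holomorphic_intros) auto
  have holo_A: "A holomorphic_on - u ` L"
    unfolding A_def by (intro holomorphic_intros) auto
  have holo_B: "B holomorphic_on {z. letter_sum z \<noteq> 1}"
    unfolding B_def by (intro holomorphic_intros holo_zeta holo_W)
  have holo_H: "H holomorphic_on - P"
    unfolding H_def P_def
    by (intro holomorphic_on_mult holomorphic_on_subset[OF holo_A] holomorphic_on_subset[OF holo_B]) auto

  have finite_P: "finite {z\<in>P. \<bar>Re z\<bar> \<le> R \<and> \<bar>Im z\<bar> \<le> R}" for R
    by (rule finite_subset[of _ "{z. letter_sum z = 1 \<and> \<bar>Re z\<bar> \<le> R \<and> \<bar>Im z\<bar> \<le> R} \<union> u ` L"])
      (use finite_letter_sum_eq_1 L in \<open>auto simp: P_def\<close>)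

  \<comment> \<open>The right half-plane \<open>C \<le> Re s\<close> is covered by \<open>right\<close>. In \<open>Re s \<le> C\<close> a boundary point lies on a
    horizontal side or, once \<open>- D < t n\<close>, in the half-plane \<open>Re s \<le> D\<close>.\<close>
  obtain C K where "0 < C" and right: "\<And>s. C \<le> Re s \<Longrightarrow> letter_sum s \<noteq> 1" "\<And>s. C \<le> Re s \<Longrightarrow> norm (B s) \<le> K"
    using remainder_bounded_right[OF \<rho>] unfolding B_def W_def by blast
  obtain D where "D < 0" and left: "\<And>s. Re s \<le> D \<Longrightarrow> letter_sum s \<noteq> 1 \<and> norm (zeta s) \<le> 2"
    using zeta_bounded_on_left by blast
  obtain k where horizontal: "\<And>n s. Re s \<le> C \<Longrightarrow> \<bar>Im s\<bar> = t n \<Longrightarrow> letter_sum s \<noteq> 1 \<and> norm (zeta s) \<le> k"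
    using zeta_bound[of C] by blast
  obtain K' where K': "\<And>s. Re s \<le> C \<Longrightarrow> norm (zeta s) \<le> max 2 k \<Longrightarrow> norm (B s) \<le> K'"
    using remainder_bounded_left[OF \<rho>, of C "max 2 k"] unfolding B_def W_def by blast
  obtain M R where "0 < R" "0 \<le> M" and A_bound: "\<And>s. R \<le> norm s \<Longrightarrow> norm (A s) \<le> M / (norm s)\<^sup>2"
    using sum_simple_fractions_bound[OF L(1) c, of u] unfolding A_def by blast
  define E where "E = Max (insert 0 ((\<lambda>l. norm (u l)) ` L))"
  have E: "norm (u l) \<le> E" if "l \<in> L" for l
    unfolding E_def using L that by (intro Max_ge) auto

  \<comment> \<open>Beyond this threshold the square contains the points \<open>u l\<close> and reaches across the strip of poles,
    and its boundary lies where the estimate of \<open>A\<close> holds.\<close>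
  have large: "\<forall>\<^sub>F n in sequentially. max (max C (- D)) (max R E) < t n"
    using t by (rule filterlim_at_top_dense[THEN iffD1, rule_format])

  have bound: "z \<notin> P \<and> norm (H z) \<le> (M * max K K') / (t n)\<^sup>2"
    if n: "max (max C (- D)) (max R E) < t n" and z: "max \<bar>Re z\<bar> \<bar>Im z\<bar> = t n" for n z
  proof
    have norm_z: "t n \<le> norm z"
      using z abs_Re_le_cmod[of z] abs_Im_le_cmod[of z] by linarith
    have "z \<notin> u ` L" using E n norm_z by force
    have B: "letter_sum z \<noteq> 1 \<and> norm (B z) \<le> max K K'"
    proof (cases "C \<le> Re z")
      case True
      then show ?thesis using right[of z] by simp
    next
      case False
      then have "\<bar>Im z\<bar> = t n \<or> Re z \<le> D" using z n by linarith
      then have "letter_sum z \<noteq> 1 \<and> norm (zeta z) \<le> max 2 k"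
        using left[of z] horizontal[of z n] False by auto
      then show ?thesis using K'[of z] False by simp
    qed
    then show "z \<notin> P" using \<open>z \<notin> u ` L\<close> by (auto simp: P_def)
    have "norm (A z) \<le> M / (norm z)\<^sup>2" using A_bound[of z] norm_z n by simp
    also have "\<dots> \<le> M / (t n)\<^sup>2"
      using norm_z n \<open>0 < R\<close> \<open>0 \<le> M\<close> by (intro divide_left_mono power_mono mult_pos_pos) auto
    finally have "norm (H z) \<le> M / (t n)\<^sup>2 * max K K'"
      unfolding H_def norm_mult using B \<open>0 \<le> M\<close> by (intro mult_mono) auto
    then show "norm (H z) \<le> (M * max K K') / (t n)\<^sup>2" by simp
  qed

  \<comment> \<open>The difference \<open>A s * \<rho> powr (- s) * W s\<close> is holomorphic near \<open>\<omega>\<close>, since \<open>\<omega>\<close> is none of the \<open>u l\<close>.\<close>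
  have residue_at_zeta_pole: "residue H \<omega> = residue (\<lambda>s. Z s * complex_of_real \<rho> powr (- s)) \<omega>" if "letter_sum \<omega> = 1" for \<omega>
  proof -
    let ?X = "- (P - {\<omega>}) \<inter> ball \<omega> 1"
    have "finite ((P - {\<omega>}) \<inter> ball \<omega> 1)"
    proof (rule finite_subset[OF _ finite_P[of "norm \<omega> + 1"]], rule subsetI)
      fix z assume z: "z \<in> (P - {\<omega>}) \<inter> ball \<omega> 1"
      then have "norm z \<le> norm \<omega> + 1"
        using norm_triangle_ineq2[of z \<omega>] by (simp add: dist_norm norm_minus_commute)
      with z show "z \<in> {z\<in>P. \<bar>Re z\<bar> \<le> norm \<omega> + 1 \<and> \<bar>Im z\<bar> \<le> norm \<omega> + 1}"
        using abs_Re_le_cmod[of z] abs_Im_le_cmod[of z] by simp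
    qed
    then have "open (ball \<omega> 1 - (P - {\<omega>}) \<inter> ball \<omega> 1)"
      by (intro open_Diff finite_imp_closed) auto
    moreover have "ball \<omega> 1 - (P - {\<omega>}) \<inter> ball \<omega> 1 = ?X" by auto
    ultimately have "open ?X" by simp
    have "\<omega> \<in> ?X" by simp
    have "\<omega> \<notin> u ` L" using that u by auto
    have holo_AW: "(\<lambda>s. A s * complex_of_real \<rho> powr (- s) * W s) holomorphic_on ?X"
      by (intro holomorphic_intros holomorphic_on_subset[OF holo_A] holo_W)
        (use \<open>\<omega> \<notin> u ` L\<close> in \<open>auto simp: P_def\<close>)
    have holo_Z: "(\<lambda>s. Z s * complex_of_real \<rho> powr (- s)) holomorphic_on ?X - {\<omega>}"
      unfolding Z_def A_def[symmetric]
      by (intro holomorphic_on_mult holomorphic_on_subset[OF holo_A] holomorphic_on_subset[OF holo_zeta] holomorphic_intros)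
        (auto simp: P_def)
    have "H = (\<lambda>s. Z s * complex_of_real \<rho> powr (- s) - A s * complex_of_real \<rho> powr (- s) * W s)"
      by (auto simp: H_def B_def Z_def A_def algebra_simps)
    then have "residue H \<omega> = residue (\<lambda>s. Z s * complex_of_real \<rho> powr (- s)) \<omega>
        - residue (\<lambda>s. A s * complex_of_real \<rho> powr (- s) * W s) \<omega>"
      using residue_diff[OF \<open>open ?X\<close> \<open>\<omega> \<in> ?X\<close> holo_Z holomorphic_on_subset[OF holo_AW Diff_subset]]
      by simp
    also have "residue (\<lambda>s. A s * complex_of_real \<rho> powr (- s) * W s) \<omega> = 0"
      by (rule residue_holo[OF \<open>open ?X\<close> \<open>\<omega> \<in> ?X\<close> holo_AW])
    finally show ?thesis by simp
  qed

  have residue_at_u: "residue H (u l) = c l * B (u l)" if l: "l \<in> L" for l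
  proof -
    let ?X = "{z. letter_sum z \<noteq> 1} \<inter> - (u ` (L - {l}))"
    \<comment> \<open>Pull out the simple pole: \<open>H s = ?g s / (s - u l)\<close> with \<open>?g\<close> holomorphic at \<open>u l\<close>.\<close>
    let ?g = "\<lambda>s. c l * B s + (s - u l) * ((\<Sum>l'\<in>L - {l}. c l' / (s - u l')) * B s)"
    have split: "(x * b + y * (g * b)) / y = (x / y + g) * b" if "y \<noteq> 0" for x y b g :: complex
      using that by (simp add: field_simps)
    have "open ?X" using L by (intro open_Int open_neq open_Compl finite_imp_closed) auto
    moreover have "u l \<in> ?X" using u l L by (auto simp: inj_on_def)
    ultimately have "residue (\<lambda>s. ?g s / (s - u l)) (u l) = ?g (u l)"
      by (intro residue_simple holomorphic_intros holomorphic_on_subset[OF holo_B]) auto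
    moreover have "\<forall>\<^sub>F s in at (u l). H s = ?g s / (s - u l)"
    proof (rule eventually_mono[OF eventually_neq_at_within])
      fix s assume "s \<noteq> u l"
      moreover have "A s = c l / (s - u l) + (\<Sum>l'\<in>L - {l}. c l' / (s - u l'))"
        unfolding A_def using L l by (simp add: sum.remove)
      moreover have "?g s / (s - u l) = (c l / (s - u l) + (\<Sum>l'\<in>L - {l}. c l' / (s - u l'))) * B s"
        using \<open>s \<noteq> u l\<close> by (intro split) simp
      ultimately show "H s = ?g s / (s - u l)" by (simp add: H_def)
    qed
    ultimately show ?thesis using residue_cong[of H "\<lambda>s. ?g s / (s - u l)" "u l" "u l"] by simp
  qed

  have "(\<lambda>n. (\<Sum>z | z \<in> P \<and> \<bar>Re z\<bar> \<le> t n \<and> \<bar>Im z\<bar> \<le> t n. residue H z)) \<longlonglongrightarrow> 0"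
    using large bound
    by (intro sum_residues_expanding_squares_tendsto_0[OF t finite_P holo_H, where M = "M * max K K'"])
      (auto elim: eventually_mono)
  then have lim: "(\<lambda>n. (\<Sum>z | z \<in> P \<and> \<bar>Re z\<bar> \<le> t n \<and> \<bar>Im z\<bar> \<le> t n. residue H z) - (\<Sum>l\<in>L. c l * B (u l)))
      \<longlonglongrightarrow> 0 - (\<Sum>l\<in>L. c l * B (u l))"
    by (intro tendsto_diff tendsto_const)
  have "\<forall>\<^sub>F n in sequentially.
    (\<Sum>z | z \<in> P \<and> \<bar>Re z\<bar> \<le> t n \<and> \<bar>Im z\<bar> \<le> t n. residue H z) - (\<Sum>l\<in>L. c l * B (u l)) =
    (\<Sum>\<omega> | letter_sum \<omega> = 1 \<and> \<bar>Im \<omega>\<bar> \<le> t n. residue (\<lambda>s. Z s * complex_of_real \<rho> powr (- s)) \<omega>)"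
    using large
  proof eventually_elim
    case (elim n)
    let ?Q = "{\<omega>. letter_sum \<omega> = 1 \<and> \<bar>Im \<omega>\<bar> \<le> t n}"
    have strip: "\<bar>Re \<omega>\<bar> \<le> t n" if "letter_sum \<omega> = 1" for \<omega>
      using right(1)[of \<omega>] left[of \<omega>] that elim by linarith
    have u_in: "\<bar>Re (u l)\<bar> \<le> t n \<and> \<bar>Im (u l)\<bar> \<le> t n" if "l \<in> L" for l
      using E[OF that] elim abs_Re_le_cmod[of "u l"] abs_Im_le_cmod[of "u l"] by linarith
    have "{z. z \<in> P \<and> \<bar>Re z\<bar> \<le> t n \<and> \<bar>Im z\<bar> \<le> t n} = ?Q \<union> u ` L"
      unfolding P_def using strip u_in by blast
    moreover have "finite ?Q"
      by (rule finite_subset[OF _ finite_letter_sum_eq_1[of "t n"]]) (use strip in auto)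
    moreover have "?Q \<inter> u ` L = {}" using u by auto
    ultimately have "(\<Sum>z | z \<in> P \<and> \<bar>Re z\<bar> \<le> t n \<and> \<bar>Im z\<bar> \<le> t n. residue H z) =
      (\<Sum>\<omega>\<in>?Q. residue H \<omega>) + (\<Sum>z\<in>u ` L. residue H z)"
      using L by (simp add: sum.union_disjoint)
    also have "(\<Sum>z\<in>u ` L. residue H z) = (\<Sum>l\<in>L. c l * B (u l))"
      using L by (simp add: sum.reindex residue_at_u)
    also have "(\<Sum>\<omega>\<in>?Q. residue H \<omega>) = (\<Sum>\<omega>\<in>?Q. residue (\<lambda>s. Z s * complex_of_real \<rho> powr (- s)) \<omega>)"
      using residue_at_zeta_pole by (intro sum.cong) auto
    finally show ?case by simp
  qed
  from Lim_transform_eventually[OF lim this] show ?thesis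
    by (simp add: B_def W_def sum_negf)
qed

end

theorem theorem5p5:
  fixes N d :: nat
    and S :: "nat \<Rightarrow> real ^ 'n \<Rightarrow> real ^ 'n"
    and r p :: "nat \<Rightarrow> real"
    and K :: "(real ^ 'n) set"
    and \<mu> :: "(real ^ 'n) measure"
    and q :: real
    and \<kappa> :: "nat \<Rightarrow> real"
    and t :: "nat \<Rightarrow> real"
    and \<rho> :: real
  assumes "d = CARD('n)" and "N \<ge> 2"
    and "\<And>i. i \<in> {1..N} \<Longrightarrow> 0 < r i \<and> r i < 1"
    and "\<And>i. i \<in> {1..N} \<Longrightarrow> similarity_with_ratio (r i) (S i)"
    and "\<And>i. i \<in> {1..N} \<Longrightarrow> 0 < p i"
    and "(\<Sum>i=1..N. p i) = 1"
    and "self_similar_set N S K"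
    and "self_similar_measure N S p \<mu>"
    and "(\<Sum>l=0..d. \<kappa> l * (sigma_ql N p r d q l - 1)) = 0"
    and "beta_exponent N p r q \<notin> {real l - real d * q | l. l \<le> d}"
    and "incseq t" and "\<And>n. 0 < t n" and "filterlim t at_top sequentially"
    and "\<And>c::real. \<exists>k::real. \<forall>\<sigma>\<le>c. \<forall>n. \<forall>z\<in>{Complex \<sigma> (t n), Complex \<sigma> (- t n)}.
           \<not> is_pole (zeta_mu N p r q) z \<and> cmod (zeta_mu N p r q z) \<le> k"
    and "0 < \<rho>" and "\<rho> < Min (r ` {1..N})"
  shows "(\<lambda>n. \<Sum>\<omega> | is_pole (zeta_mu N p r q) \<omega> \<and> \<bar>Im \<omega>\<bar> \<le> t n.
             residue (\<lambda>s. Z_mu N p r d \<kappa> q s * complex_of_real \<rho> powr (- s)) \<omega>)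
         \<longlonglongrightarrow> complex_of_real (V_sym N p r d \<kappa> q \<rho>)"
proof -
  note r = assms(3) and p = assms(5) and consistent = assms(9) and zeta_bound = assms(14)
  define a where "a i = p i powr q" for i
  interpret weighted_ratio_list N r a
    using assms(2) r p by unfold_locales (auto simp: a_def order_less_imp_not_eq2)
  have "\<rho> < 1"
  proof -
    have "1 \<in> {1..N}" using assms(2) by simp
    then have "Min (r ` {1..N}) \<le> r 1" by (intro Min_le) auto
    with assms(16) r[OF \<open>1 \<in> {1..N}\<close>] show ?thesis by simp
  qed
  note \<rho> = assms(15) this
  define \<sigma> where "\<sigma> = sigma_ql N p r d q"
  define u where "u l = real l - real d * q" for l
  define c where "c l = \<kappa> l * (\<sigma> l - 1)" for l
  define W where "W l = (\<Sum>w\<in>long_words N r \<rho>. word_prod p w powr q * word_prod r w powr u l)" for l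

  have letter_sum_alt: "letter_sum = (\<lambda>s. \<Sum>i=1..N. complex_of_real (p i powr q) * complex_of_real (r i) powr s)"
    by (simp add: letter_sum_def[abs_def] a_def)
  have zeta_eq: "zeta_mu N p r q = zeta"
    by (auto simp: zeta_mu_def zeta_def letter_sum_alt)
  have Z_eq: "Z_mu N p r d \<kappa> q = (\<lambda>s. (\<Sum>l\<in>{0..d}. complex_of_real (c l) / (s - complex_of_real (u l))) * zeta s)"
    by (auto simp: Z_mu_def zeta_eq c_def \<sigma>_def u_def)
  have letter_sum_u: "letter_sum (complex_of_real (u l)) = complex_of_real (\<sigma> l)" for l
    unfolding letter_sum_of_real by (simp add: \<sigma>_def sigma_ql_def a_def u_def)
  \<comment> \<open>The real function \<open>b \<mapsto> (\<Sum>i. p\<^sub>i\<^sup>q r\<^sub>i\<^sup>b)\<close> is strictly decreasing, so a solution \<open>u l\<close> would be the unique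
    one and thus equal to \<open>\<beta>(q)\<close>.\<close>
  have \<sigma>_neq_1: "\<sigma> l \<noteq> 1" if "l \<le> d" for l
  proof
    assume "\<sigma> l = 1"
    then have "(\<Sum>i=1..N. p i powr q * r i powr u l) = 1" by (simp add: \<sigma>_def sigma_ql_def u_def)
    moreover have "b = b'"
      if "(\<Sum>i=1..N. p i powr q * r i powr b) = 1" "(\<Sum>i=1..N. p i powr q * r i powr b') = 1" for b b'
    proof -
      have "(\<Sum>i=1..N. p i powr q * r i powr y) < (\<Sum>i=1..N. p i powr q * r i powr x)" if "x < y" for x y
        using that assms(2) r p by (intro sum_strict_mono mult_strict_left_mono powr_less_mono')
          (auto simp: order_less_imp_not_eq2)
      from this[of b b'] this[of b' b] that show ?thesis by (cases b b' rule: linorder_cases) auto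
    qed
    ultimately have "beta_exponent N p r q = u l"
      unfolding beta_exponent_def by (intro the_equality) blast+
    with assms(10) \<open>l \<le> d\<close> show False by (auto simp: u_def)
  qed

  have "(\<lambda>n. \<Sum>\<omega> | letter_sum \<omega> = 1 \<and> \<bar>Im \<omega>\<bar> \<le> t n. residue (\<lambda>s. Z_mu N p r d \<kappa> q s * complex_of_real \<rho> powr (- s)) \<omega>)
    \<longlonglongrightarrow> (\<Sum>l\<in>{0..d}. - (complex_of_real (c l) * (complex_of_real \<rho> powr (- complex_of_real (u l)) *
      (zeta (complex_of_real (u l)) - word_sum (long_words N r \<rho>) (complex_of_real (u l))))))"
    unfolding Z_eq
  proof (rule residue_sum_tendsto[OF _ _ _ _ \<rho> assms(13)])
    show "inj_on (\<lambda>l. complex_of_real (u l)) {0..d}" by (auto simp: inj_on_def u_def)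
    have "(\<Sum>l=0..d. c l) = 0" using consistent by (simp add: c_def \<sigma>_def)
    then show "(\<Sum>l=0..d. complex_of_real (c l)) = 0" unfolding of_real_sum[symmetric] by simp
    show "letter_sum (complex_of_real (u l)) \<noteq> 1" if "l \<in> {0..d}" for l
      using \<sigma>_neq_1[of l] that by (simp add: letter_sum_u)
    show "\<exists>k. \<forall>n s. Re s \<le> C \<longrightarrow> \<bar>Im s\<bar> = t n \<longrightarrow> letter_sum s \<noteq> 1 \<and> norm (zeta s) \<le> k" for C
    proof -
      obtain k where k: "\<And>\<sigma> n z. \<sigma> \<le> C \<Longrightarrow> z \<in> {Complex \<sigma> (t n), Complex \<sigma> (- t n)} \<Longrightarrow> letter_sum z \<noteq> 1 \<and> norm (zeta z) \<le> k"
        using zeta_bound[of C] unfolding zeta_eq is_pole_zeta_iff by blast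
      have "letter_sum s \<noteq> 1 \<and> norm (zeta s) \<le> k" if "Re s \<le> C" "\<bar>Im s\<bar> = t n" for s n
        using that by (intro k[of "Re s" _ n]) (auto simp: complex_eq_iff)
      then show ?thesis by blast
    qed
  qed simp
  also have "(\<Sum>l\<in>{0..d}. - (complex_of_real (c l) * (complex_of_real \<rho> powr (- complex_of_real (u l)) *
      (zeta (complex_of_real (u l)) - word_sum (long_words N r \<rho>) (complex_of_real (u l)))))) =
    complex_of_real (\<Sum>l=0..d. \<kappa> l * (\<sigma> l + (\<sigma> l - 1) * W l) * \<rho> powr - u l)"
    unfolding of_real_sum
  proof (rule sum.cong[OF refl])
    fix l assume "l \<in> {0..d}"
    then have "\<sigma> l \<noteq> 1" by (intro \<sigma>_neq_1) simp
    have "zeta (complex_of_real (u l)) = complex_of_real (\<sigma> l / (1 - \<sigma> l))"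
      by (simp add: zeta_def letter_sum_u)
    moreover have "word_sum (long_words N r \<rho>) (complex_of_real (u l)) = complex_of_real (W l)"
      unfolding word_sum_def W_def of_real_sum
    proof (rule sum.cong[OF refl])
      fix w assume "w \<in> long_words N r \<rho>"
      then have w: "w \<in> lists {1..N}" by (intro words_in_lists) (simp add: long_words_def)
      have "word_prod a w = word_prod p w powr q"
        unfolding a_def using w p by (intro word_prod_powr) auto
      then show "complex_of_real (word_prod a w) * complex_of_real (word_prod r w) powr complex_of_real (u l) =
        complex_of_real (word_prod p w powr q * word_prod r w powr u l)"
        using word_prod_r_pos[OF w] by (simp add: powr_of_real)
    qed
    moreover have "complex_of_real \<rho> powr (- complex_of_real (u l)) = complex_of_real (\<rho> powr - u l)"
      using \<rho> powr_of_real[of \<rho> "- u l"] by simp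
    ultimately have "- (complex_of_real (c l) * (complex_of_real \<rho> powr (- complex_of_real (u l)) *
      (zeta (complex_of_real (u l)) - word_sum (long_words N r \<rho>) (complex_of_real (u l))))) =
      complex_of_real (- (c l * (\<rho> powr - u l * (\<sigma> l / (1 - \<sigma> l) - W l))))"
      by simp
    also have "- (c l * (\<rho> powr - u l * (\<sigma> l / (1 - \<sigma> l) - W l))) =
      \<kappa> l * (\<sigma> l + (\<sigma> l - 1) * W l) * \<rho> powr - u l"
      using \<open>\<sigma> l \<noteq> 1\<close> by (simp add: c_def divide_simps) algebra
    finally show "- (complex_of_real (c l) * (complex_of_real \<rho> powr (- complex_of_real (u l)) *
      (zeta (complex_of_real (u l)) - word_sum (long_words N r \<rho>) (complex_of_real (u l))))) =
      complex_of_real (\<kappa> l * (\<sigma> l + (\<sigma> l - 1) * W l) * \<rho> powr - u l)" .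
  qed
  also have "(\<Sum>l=0..d. \<kappa> l * (\<sigma> l + (\<sigma> l - 1) * W l) * \<rho> powr - u l) = V_sym N p r d \<kappa> q \<rho>"
    unfolding \<sigma>_def W_def u_def
    using V_sym_eq[OF ratio_list_axioms p \<rho> consistent] by simp
  finally show ?thesis
    by (simp add: zeta_eq is_pole_zeta_iff)
qed

end
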